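(* Let $W\in\mathbb{N}$, $\alpha\in(0,1)$, $c\ge1/4$, and define for $m\in[0,1]^W$ the union-bounding test $$T'_t(m,\alpha)=\prod_{a\in[W]}\mathbf{1}\left[\max_{1\le i\le t}K_i^a(m_a)\ge W/\alpha\right]$$ and the averaged test $$T_t(m,\alpha)=\mathbf{1}\left[\max_{1\le i\le t}E_i(m)\ge1/\alpha\right].$$ For all $t\in\mathbb{N}$ and any realization of the data, every $m\in[0,1]^W$ rejected by $T'_t(m,\alpha)$ (i.e. with $T'_t(m,\alpha)=1$) is also rejected by $T_t(m,\alpha)$ (i.e. $T_t(m,\alpha)=1$).
   Context: $[W]=\{1,\dots,W\}$ indexes the arms. The data are pairs $(A_i,X_i)\in[W]\times[0,1]$, $i=1,2,\dots$. Let $N_t(a)=\sum_{i=1}^t\mathbf{1}[A_i=a]$ and $\hat\mu_t(a)=\frac{1}{N_t(a)}\sum_{i=1}^t\mathbf{1}[A_i=a]X_i$; if $N_{t}(a)=0$, set $\hat\mu_{t}(a)=m_a$. For $m=(m_1,\dots,m_W)\in[0,1]^W$, $$K_t^a(m_a)=\prod_{i=1}^t\left(1-\mathbf{1}[A_i=a]+\mathbf{1}[A_i=a]\left(1+\frac{(\hat\mu_{i-1}(a)-m_a)(X_i-m_a)}{c}\right)\right),\qquad E_t(m)=\frac1W\sum_{a\in[W]}K_t^a(m_a).$$ *)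

theory Defs
  imports Complex_Main "HOL-Library.FuncSet"
begin

(* Arms are {1..W}. The data are A i, X i for i >= 1; the values A 0 and X 0 are never used.
   A vector m in [0,1]^W is a function on nat of which only the values on {1..W} matter. *)

definition pull_count :: "(nat \<Rightarrow> nat) \<Rightarrow> nat \<Rightarrow> nat \<Rightarrow> nat" where
  "pull_count A t a = (\<Sum>i=1..t. of_bool (A i = a))"

(* The last argument is m_a, the value used while arm a has not been pulled. *)
definition mu_hat :: "(nat \<Rightarrow> nat) \<Rightarrow> (nat \<Rightarrow> real) \<Rightarrow> nat \<Rightarrow> nat \<Rightarrow> real \<Rightarrow> real" where
  "mu_hat A X t a ma =
     (if pull_count A t a = 0 then ma
      else 1 / real (pull_count A t a) * (\<Sum>i=1..t. of_bool (A i = a) * X i))"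

definition arm_process ::
  "real \<Rightarrow> (nat \<Rightarrow> nat) \<Rightarrow> (nat \<Rightarrow> real) \<Rightarrow> nat \<Rightarrow> nat \<Rightarrow> real \<Rightarrow> real" where
  "arm_process c A X t a ma =
     (\<Prod>i=1..t. 1 - of_bool (A i = a)
        + of_bool (A i = a) * (1 + (mu_hat A X (i - 1) a ma - ma) * (X i - ma) / c))"

definition avg_process ::
  "nat \<Rightarrow> real \<Rightarrow> (nat \<Rightarrow> nat) \<Rightarrow> (nat \<Rightarrow> real) \<Rightarrow> nat \<Rightarrow> (nat \<Rightarrow> real) \<Rightarrow> real" where
  "avg_process W c A X t m = 1 / real W * (\<Sum>a\<in>{1..W}. arm_process c A X t a (m a))"

(* Both tests take a maximum over {1..t} and are meaningful only for t >= 1. *)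
definition union_test ::
  "nat \<Rightarrow> real \<Rightarrow> (nat \<Rightarrow> nat) \<Rightarrow> (nat \<Rightarrow> real) \<Rightarrow> nat \<Rightarrow> (nat \<Rightarrow> real) \<Rightarrow> real \<Rightarrow> nat" where
  "union_test W c A X t m \<alpha> =
     (\<Prod>a\<in>{1..W}. of_bool ((MAX i\<in>{1..t}. arm_process c A X i a (m a)) \<ge> real W / \<alpha>))"

definition avg_test ::
  "nat \<Rightarrow> real \<Rightarrow> (nat \<Rightarrow> nat) \<Rightarrow> (nat \<Rightarrow> real) \<Rightarrow> nat \<Rightarrow> (nat \<Rightarrow> real) \<Rightarrow> real \<Rightarrow> nat" where
  "avg_test W c A X t m \<alpha> =
     of_bool ((MAX i\<in>{1..t}. avg_process W c A X i m) \<ge> 1 / \<alpha>)"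

end

theory Submission
  imports Defs
begin

text \<open>
  Since \<open>(u - m) (x - m) = ((u + x)/2 - m)\<^sup>2 - ((u - x)/2)\<^sup>2 \<ge> -1/4\<close> for \<open>u, x\<close> in the unit
  interval, \<open>c \<ge> 1/4\<close> makes every factor of every arm process nonnegative. Hence the average
  dominates each single process divided by \<open>W\<close>, and one arm crossing \<open>W/\<alpha>\<close> already makes the
  average cross \<open>1/\<alpha>\<close> at the same time.
\<close>

text \<open>Before the first pull the value is the default \<open>ma\<close>, afterwards a mean of
  observations from the unit interval.\<close>

lemma mu_hat_unit_interval:
  assumes X: "\<And>i. i \<ge> 1 \<Longrightarrow> X i \<in> {0..1}" and ma: "ma \<in> {0..1}"
  shows "mu_hat A X t a ma \<in> {0..1}"
proof (cases "pull_count A t a = 0")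
  case True
  then show ?thesis using ma by (simp add: mu_hat_def)
next
  case False
  let ?S = "\<Sum>i=1..t. of_bool (A i = a) * X i"
  have "?S \<ge> 0" using X by (intro sum_nonneg) auto
  moreover have "?S \<le> real (pull_count A t a)"
    unfolding pull_count_def of_nat_sum using X by (intro sum_mono) auto
  ultimately show ?thesis
    \<comment> \<open>The sum must keep the shape of \<open>?S\<close>, in which both bounds are
      stated.\<close>
    using False by (simp add: mu_hat_def del: sum_of_bool_mult_eq)
qed

lemma prod_diff_ge_neg_quarter:
  fixes u x m :: real
  assumes "u \<in> {0..1}" and "x \<in> {0..1}"
  shows "(u - m) * (x - m) \<ge> - 1 / 4"
proof -
  have "\<bar>u - x\<bar> \<le> 1" using assms by auto
  then have "(u - x)\<^sup>2 \<le> 1" by (simp add: abs_square_le_1)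
  moreover have "(u - m) * (x - m) = ((u + x) / 2 - m)\<^sup>2 - (u - x)\<^sup>2 / 4"
    by (simp add: power2_eq_square field_simps)
  moreover have "((u + x) / 2 - m)\<^sup>2 \<ge> 0" by simp
  ultimately show ?thesis by linarith
qed

lemma arm_process_nonneg:
  assumes c: "c \<ge> 1 / 4" and X: "\<And>i. i \<ge> 1 \<Longrightarrow> X i \<in> {0..1}" and ma: "ma \<in> {0..1}"
  shows "arm_process c A X t a ma \<ge> 0"
  unfolding arm_process_def
proof (intro prod_nonneg)
  fix i assume i: "i \<in> {1..t}"
  let ?q = "(mu_hat A X (i - 1) a ma - ma) * (X i - ma)"
  have "?q \<ge> - 1 / 4"
    \<comment> \<open>\<open>X\<close> is constrained only from index 1 on, hence the use of
      \<open>i\<close>. At \<open>i = 1\<close> the estimate is the default \<open>ma\<close>, so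
      \<open>?q = 0\<close>.\<close>
    using i by (intro prod_diff_ge_neg_quarter mu_hat_unit_interval X ma) auto
  then have "1 + ?q / c \<ge> 0" using c by (simp add: field_simps)
  then show "0 \<le> 1 - of_bool (A i = a) + of_bool (A i = a) * (1 + ?q / c)"
    by simp
qed

lemma avg_process_ge_arm_process:
  assumes "c \<ge> 1 / 4" and "\<And>i. i \<ge> 1 \<Longrightarrow> X i \<in> {0..1}" and "m \<in> {1..W} \<rightarrow> {0..1}"
    and "a \<in> {1..W}"
  shows "avg_process W c A X t m \<ge> arm_process c A X t a (m a) / real W"
proof -
  have "arm_process c A X t a (m a) \<le> (\<Sum>a\<in>{1..W}. arm_process c A X t a (m a))"
    using assms by (intro member_le_sum arm_process_nonneg) auto
  then show ?thesis by (simp add: avg_process_def divide_right_mono)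
qed

theorem lemma4:
  fixes W t :: nat and \<alpha> c :: real
    and A :: "nat \<Rightarrow> nat" and X :: "nat \<Rightarrow> real" and m :: "nat \<Rightarrow> real"
  assumes "W \<ge> 1" and "0 < \<alpha>" and "\<alpha> < 1" and "c \<ge> 1 / 4" and "t \<ge> 1"
    and "\<And>i. i \<ge> 1 \<Longrightarrow> (A i, X i) \<in> {1..W} \<times> {0..1}"
    and "m \<in> {1..W} \<rightarrow> {0..1}"
    and "union_test W c A X t m \<alpha> = 1"
  shows "avg_test W c A X t m \<alpha> = 1"
proof -
  have X: "\<And>i. i \<ge> 1 \<Longrightarrow> X i \<in> {0..1}" using assms(6) by blast
  \<comment> \<open>The union test makes every arm cross, so any one can be the witness; arm 1
    exists because \<open>W \<ge> 1\<close>.\<close>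
  have one: "1 \<in> {1..W}" using assms(1) by simp
  let ?K = "\<lambda>i. arm_process c A X i 1 (m 1)"
  have "(MAX i\<in>{1..t}. ?K i) \<ge> real W / \<alpha>"
  \<comment> \<open>The test is a product of indicators, so failure at arm 1 alone would make it
    0.\<close>
  proof (rule ccontr)
    assume "\<not> ?thesis"
    then have "union_test W c A X t m \<alpha> = 0"
      unfolding union_test_def using one by (intro prod_zero bexI[of _ 1]) auto
    then show False using assms(8) by simp
  qed
  \<comment> \<open>As \<open>t \<ge> 1\<close>, the maximum is over a nonempty set and is reached
    at some time; the average is evaluated at this same \<open>i\<close>.\<close>
  then obtain i where i: "i \<in> {1..t}" and K: "?K i \<ge> real W / \<alpha>"
    using assms(5) by (auto simp: Max_ge_iff)
  have "1 / \<alpha> = real W / \<alpha> / real W" using assms(1) by simp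
  also have "\<dots> \<le> ?K i / real W" using K by (intro divide_right_mono) auto
  also have "\<dots> \<le> avg_process W c A X i m"
    using assms(4) X assms(7) one by (rule avg_process_ge_arm_process)
  also have "\<dots> \<le> (MAX i\<in>{1..t}. avg_process W c A X i m)"
    using i by (intro Max_ge) auto
  finally show ?thesis by (simp add: avg_test_def)
qed

end
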